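(* Let $X$ be an infinite-dimensional locally convex space. Then the set $$\mathcal{L}(X) \setminus \left(\mathcal{DR}(X) \cup \mathcal{CYC}(X) \cup \mathcal{INJ}(X)\right)$$ is SOT-dense-lineable in $\mathcal{L}(X)$; that is, there exists a vector subspace $V$ of $\mathcal{L}(X)$, dense in $\mathcal{L}(X)$ for the strong operator topology, such that every nonzero $T \in V$ is not of dense range, not cyclic and not injective.
   Context: All topological vector spaces are Hausdorff and over the field $\mathbb{K} = \mathbb{R}$ or $\mathbb{C}$. For a topological vector space $X$, $\mathcal{L}(X)$ is the vector space of all continuous linear operators $X \to X$. An operator $T \in \mathcal{L}(X)$ is cyclic if there is $x_0 \in X$ such that $\mathrm{span}\{T^n x_0 : n \ge 0\}$ is dense in $X$. Notation: $\mathcal{CYC}(X)$, $\mathcal{DR}(X)$, $\mathcal{INJ}(X)$ are the sets of $T \in \mathcal{L}(X)$ that are cyclic, have dense range, are injective, respectively. The strong operator topology (SOT) on $\mathcal{L}(X)$ is the topology of pointwise convergence: a net $(T_\alpha)$ converges to $T$ iff $T_\alpha(x) \to T(x)$ in $X$ for every $x \in X$. A subset $A$ of a topological vector space $E$ is dense-lineable if there is a dense vector subspace $V \subset E$ with $V \subset A \cup \{0\}$; SOT-dense-lineable means dense-lineable in $E = \mathcal{L}(X)$ with the SOT. *)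

theory Defs
  imports "HOL-Analysis.Analysis" "HOL-Library.Function_Algebras"
begin

section \<open>Topological vector spaces\<close>

text \<open>The scalar field is the type \<open>'k\<close>, to be instantiated with \<^typ>\<open>real\<close> or \<^typ>\<open>complex\<close>.
  The space is the type \<open>'a\<close>; its sort contributes the continuity of the group operations
  and the Hausdorff property.\<close>

locale topological_vector_space = vector_space sc
  for sc :: "'k::real_normed_field \<Rightarrow> 'a::{topological_ab_group_add, t2_space} \<Rightarrow> 'a" +
  assumes continuous_scale: "continuous_on UNIV (\<lambda>(c, x). sc c x)"

definition convex_wrt :: "('k::real_normed_field \<Rightarrow> 'a::ab_group_add \<Rightarrow> 'a) \<Rightarrow> 'a set \<Rightarrow> bool" where
  "convex_wrt sc C \<longleftrightarrow>
     (\<forall>x\<in>C. \<forall>y\<in>C. \<forall>u\<ge>0. \<forall>v\<ge>0. u + v = 1 \<longrightarrow> sc (of_real u) x + sc (of_real v) y \<in> C)"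

locale locally_convex_space = topological_vector_space sc
  for sc :: "'k::real_normed_field \<Rightarrow> 'a::{topological_ab_group_add, t2_space} \<Rightarrow> 'a" +
  assumes convex_nhd_base: "open U \<Longrightarrow> 0 \<in> U \<Longrightarrow> \<exists>C. convex_wrt sc C \<and> 0 \<in> interior C \<and> C \<subseteq> U"

definition infinite_dimensional :: "('k::field \<Rightarrow> 'a::ab_group_add \<Rightarrow> 'a) \<Rightarrow> bool" where
  "infinite_dimensional sc \<longleftrightarrow> (\<nexists>B. finite_dimensional_vector_space sc B)"

section \<open>Continuous linear operators\<close>

definition continuous_operators ::
    "('k::field \<Rightarrow> 'a::{ab_group_add, topological_space} \<Rightarrow> 'a) \<Rightarrow> ('a \<Rightarrow> 'a) set" where
  "continuous_operators sc = {T. Vector_Spaces.linear sc sc T \<and> continuous_on UNIV T}"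

definition cyclic_operators ::
    "('k::field \<Rightarrow> 'a::{ab_group_add, topological_space} \<Rightarrow> 'a) \<Rightarrow> ('a \<Rightarrow> 'a) set" where
  "cyclic_operators sc = {T \<in> continuous_operators sc.
     \<exists>x\<^sub>0. closure (module.span sc (range (\<lambda>n. (T ^^ n) x\<^sub>0))) = UNIV}"

definition dense_range_operators ::
    "('k::field \<Rightarrow> 'a::{ab_group_add, topological_space} \<Rightarrow> 'a) \<Rightarrow> ('a \<Rightarrow> 'a) set" where
  "dense_range_operators sc = {T \<in> continuous_operators sc. closure (range T) = UNIV}"

definition injective_operators ::
    "('k::field \<Rightarrow> 'a::{ab_group_add, topological_space} \<Rightarrow> 'a) \<Rightarrow> ('a \<Rightarrow> 'a) set" where
  "injective_operators sc = {T \<in> continuous_operators sc. inj T}"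

section \<open>Strong operator topology and dense lineability\<close>

definition sot ::
    "('k::field \<Rightarrow> 'a::{ab_group_add, topological_space} \<Rightarrow> 'a) \<Rightarrow> ('a \<Rightarrow> 'a) topology" where
  "sot sc = subtopology (product_topology (\<lambda>_. euclidean) UNIV) (continuous_operators sc)"

lemma topspace_sot [simp]: "topspace (sot sc) = continuous_operators sc"
  by (simp add: sot_def)

lemma limitin_sot:
  "limitin (sot sc) T S F \<longleftrightarrow>
     S \<in> continuous_operators sc \<and> (\<forall>\<^sub>F i in F. T i \<in> continuous_operators sc) \<and>
     (\<forall>x. ((\<lambda>i. T i x) \<longlongrightarrow> S x) F)"
  by (auto simp: sot_def limitin_subtopology limitin_componentwise)

text \<open>Addition and zero of operators are those of \<^theory>\<open>HOL-Library.Function_Algebras\<close>.\<close>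

definition scale_fun :: "('k \<Rightarrow> 'a \<Rightarrow> 'a) \<Rightarrow> 'k \<Rightarrow> ('b \<Rightarrow> 'a) \<Rightarrow> 'b \<Rightarrow> 'a" where
  "scale_fun sc c T = (\<lambda>x. sc c (T x))"

lemma vector_space_scale_fun:
  assumes "vector_space sc"
  shows "vector_space (scale_fun sc)"
proof -
  interpret vector_space sc by fact
  show ?thesis
    by unfold_locales
      (simp_all add: scale_fun_def fun_eq_iff scale_right_distrib scale_left_distrib)
qed

lemma subspace_continuous_operators:
  assumes "topological_vector_space sc"
  shows "module.subspace (scale_fun sc) (continuous_operators sc)"
proof -
  interpret topological_vector_space sc by fact
  interpret F: vector_space "scale_fun sc"
    by (rule vector_space_scale_fun) unfold_locales
  interpret P: vector_space_pair sc sc ..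
  have cont: "continuous_on UNIV (\<lambda>x. sc c (T x))" if "continuous_on UNIV T" for c T
    using continuous_on_compose2[OF continuous_scale
        continuous_on_Pair[OF continuous_on_const[of UNIV c] that]]
    by simp
  show ?thesis
    by (auto simp: F.subspace_def continuous_operators_def scale_fun_def zero_fun_def plus_fun_def
        P.linear_zero P.linear_compose_add P.linear_compose_scale_right
        intro: continuous_on_add cont)
qed

text \<open>The topological vector space \<open>E\<close> is \<^term>\<open>topspace E\<close>, a subspace of the type
  \<open>'e\<close> with scalar multiplication \<open>sc\<close>.\<close>

definition dense_lineable ::
    "('k::field \<Rightarrow> 'e::ab_group_add \<Rightarrow> 'e) \<Rightarrow> 'e topology \<Rightarrow> 'e set \<Rightarrow> bool" where
  "dense_lineable sc E A \<longleftrightarrow> A \<subseteq> topspace E \<and>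
     (\<exists>V. module.subspace sc V \<and> V \<subseteq> topspace E \<and> E closure_of V = topspace E \<and> V \<subseteq> A \<union> {0})"

definition sot_dense_lineable ::
    "('k::field \<Rightarrow> 'a::{ab_group_add, topological_space} \<Rightarrow> 'a) \<Rightarrow> ('a \<Rightarrow> 'a) set \<Rightarrow> bool" where
  "sot_dense_lineable sc = dense_lineable (scale_fun sc) (sot sc)"

end

theory Submission
  imports Defs
begin

text \<open>The continuous operators of finite rank form a subspace that is SOT-dense: given \<open>T\<close> and
  finitely many points, the Hahn--Banach theorem provides continuous functionals biorthogonal to a
  basis of their span, and with these one writes down a finite rank operator that agrees with \<open>T\<close>
  at the given points. In infinite dimension an operator of finite rank is not injective, and a
  finite-dimensional subspace is not dense; this excludes dense range, and also cyclicity, because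
  an orbit of \<open>T\<close> lies in the span of its initial point and the range of \<open>T\<close>.\<close>

section \<open>The Hahn--Banach theorem\<close>

text \<open>Homogeneity is asked as an inequality for \<open>r > 0\<close>, the form that passes
  directly to infima; equality follows by using it for \<open>r\<close> and
  \<open>1 / r\<close>.\<close>

definition sublinear :: "(real \<Rightarrow> 'a::ab_group_add \<Rightarrow> 'a) \<Rightarrow> ('a \<Rightarrow> real) \<Rightarrow> bool" where
  "sublinear sc p \<longleftrightarrow> (\<forall>x y. p (x + y) \<le> p x + p y) \<and> (\<forall>r>0. \<forall>x. p (sc r x) \<le> r * p x)"

lemma sublinearI:
  assumes "\<And>x y. p (x + y) \<le> p x + p y" "\<And>r x. r > 0 \<Longrightarrow> p (sc r x) \<le> r * p x"
  shows "sublinear sc p"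
  using assms by (simp add: sublinear_def)

lemma sublinear_add: "sublinear sc p \<Longrightarrow> p (x + y) \<le> p x + p y"
  by (simp add: sublinear_def)

lemma sublinear_scale_le: "sublinear sc p \<Longrightarrow> r > 0 \<Longrightarrow> p (sc r x) \<le> r * p x"
  by (simp add: sublinear_def)

context
  fixes sc :: "real \<Rightarrow> 'a::ab_group_add \<Rightarrow> 'a"
  assumes vs: "vector_space sc"
begin

interpretation vector_space sc by (rule vs)

lemma sublinear_zero:
  assumes "sublinear sc p"
  shows "p 0 = 0"
  \<comment> \<open>The factor 2 gives \<open>0 \<le> p 0\<close>, the factor 1/2 gives
    \<open>p 0 \<le> 0\<close>.\<close>
  using sublinear_scale_le[OF assms, of 2 0] sublinear_scale_le[OF assms, of "1/2" 0] by simp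

lemma sublinear_scale:
  assumes p: "sublinear sc p" and "r \<ge> 0"
  shows "p (sc r x) = r * p x"
proof (cases "r = 0")
  case True
  then show ?thesis by (simp add: sublinear_zero[OF p])
next
  case False
  with assms have r: "r > 0" by simp
  have "p (sc (1/r) (sc r x)) \<le> 1/r * p (sc r x)"
    using r by (intro sublinear_scale_le[OF p]) simp
  then have "r * p x \<le> p (sc r x)"
    using r by (simp add: field_simps)
  with sublinear_scale_le[OF p r, of x] show ?thesis by simp
qed

text \<open>Subadditivity at \<open>x + (- x) = 0\<close>. It bounds all sublinear
  \<open>q \<le> p\<close> below by \<open>- p (- x)\<close> at \<open>x\<close>, so that infima
  over chains are finite.\<close>

lemma sublinear_neg:
  assumes p: "sublinear sc p"
  shows "- p (- x) \<le> p x"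
  using sublinear_add[OF p, of x "- x"] by (simp add: sublinear_zero[OF p])

text \<open>A sublinear functional below \<open>p\<close> that is linear along the direction \<open>y\<close>.\<close>

definition sublinear_shift :: "('a \<Rightarrow> real) \<Rightarrow> 'a \<Rightarrow> 'a \<Rightarrow> real" where
  "sublinear_shift p y x = (INF t\<in>{0..}. p (x + sc t y) - t * p y)"

lemma sublinear_shift_le:
  assumes p: "sublinear sc p" and "t \<ge> 0"
  shows "sublinear_shift p y x \<le> p (x + sc t y) - t * p y"
  unfolding sublinear_shift_def
proof (rule cINF_lower)
  \<comment> \<open>Subadditivity for \<open>sc t y = - x + (x + sc t y)\<close> gives a lower bound
    independent of \<open>t\<close>.\<close>
  have "- p (- x) \<le> p (x + sc t y) - t * p y" if "t \<ge> 0" for t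
    using sublinear_add[OF p, of "- x" "x + sc t y"] sublinear_scale[OF p that, of y] by simp
  then show "bdd_below ((\<lambda>t. p (x + sc t y) - t * p y) ` {0..})"
    by (intro bdd_belowI[of _ "- p (- x)"]) auto
qed (use assms in simp)

lemma sublinear_shift_greatest:
  assumes "\<And>t. t \<ge> 0 \<Longrightarrow> a \<le> p (x + sc t y) - t * p y"
  shows "a \<le> sublinear_shift p y x"
  unfolding sublinear_shift_def by (rule cINF_greatest) (use assms in auto)

lemma sublinear_shift_le_self:
  assumes "sublinear sc p"
  shows "sublinear_shift p y x \<le> p x"
  using sublinear_shift_le[OF assms, of 0 y x] by simp

lemma sublinear_sublinear_shift:
  assumes p: "sublinear sc p"
  shows "sublinear sc (sublinear_shift p y)"
proof (rule sublinearI)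
  fix u v
  \<comment> \<open>Parameters \<open>s\<close> for \<open>u\<close> and \<open>t\<close> for
    \<open>v\<close> combine to \<open>s + t\<close> for \<open>u + v\<close>; the infima over
    \<open>t\<close> and over \<open>s\<close> are then taken one after the other.\<close>
  have *: "sublinear_shift p y (u + v) \<le> (p (u + sc s y) - s * p y) + (p (v + sc t y) - t * p y)"
    if "s \<ge> 0" "t \<ge> 0" for s t
    using sublinear_shift_le[OF p, of "s + t" y "u + v"] that
      sublinear_add[OF p, of "u + sc s y" "v + sc t y"]
    by (simp add: algebra_simps scale_left_distrib)
  have "sublinear_shift p y (u + v) - (p (u + sc s y) - s * p y) \<le> sublinear_shift p y v"
    if "s \<ge> 0" for s
    using *[OF that] by (intro sublinear_shift_greatest) (simp add: algebra_simps)
  then have "sublinear_shift p y (u + v) - sublinear_shift p y v \<le> sublinear_shift p y u"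
    by (intro sublinear_shift_greatest) (simp add: algebra_simps)
  then show "sublinear_shift p y (u + v) \<le> sublinear_shift p y u + sublinear_shift p y v"
    by simp
next
  fix r :: real and x
  assume r: "r > 0"
  \<comment> \<open>The parameter \<open>t\<close> for \<open>x\<close> corresponds to
    \<open>r * t\<close> for \<open>sc r x\<close>.\<close>
  have "sublinear_shift p y (sc r x) / r \<le> p (x + sc t y) - t * p y" if "t \<ge> 0" for t
    using sublinear_shift_le[OF p, of "r * t" y "sc r x"] that r
      sublinear_scale_le[OF p r, of "x + sc t y"]
    by (simp add: scale_right_distrib divide_simps algebra_simps)
  then have "sublinear_shift p y (sc r x) / r \<le> sublinear_shift p y x"
    by (rule sublinear_shift_greatest)
  then show "sublinear_shift p y (sc r x) \<le> r * sublinear_shift p y x"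
    using r by (simp add: field_simps)
qed

section \<open>Linear functionals as minimal sublinear functionals\<close>

text \<open>The pointwise infimum works. For its subadditivity, \<open>q x + q' y\<close> with two
  members of the chain is bounded below by using the smaller member at both points.\<close>

lemma sublinear_chain_lower_bound:
  assumes C: "C \<noteq> {}" and sub: "\<And>q. q \<in> C \<Longrightarrow> sublinear sc q"
    and le: "\<And>q. q \<in> C \<Longrightarrow> q \<le> p"
    and chain: "\<And>q q'. q \<in> C \<Longrightarrow> q' \<in> C \<Longrightarrow> q \<le> q' \<or> q' \<le> q"
  shows "\<exists>u. sublinear sc u \<and> (\<forall>q\<in>C. u \<le> q)"
proof -
  define u where "u x = (INF q\<in>C. q x)" for x
  have lower: "u x \<le> q x" if "q \<in> C" for q x
    unfolding u_def
  proof (rule cINF_lower[OF _ that])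
    have "- p (- x) \<le> q x" if "q \<in> C" for q
      using sublinear_neg[OF sub[OF that], of x] le_funD[OF le[OF that], of "- x"] by simp
    then show "bdd_below ((\<lambda>q. q x) ` C)"
      by (intro bdd_belowI[of _ "- p (- x)"]) auto
  qed
  have greatest: "a \<le> u x" if "\<And>q. q \<in> C \<Longrightarrow> a \<le> q x" for a x
    unfolding u_def by (rule cINF_greatest) (use C that in auto)
  have "sublinear sc u"
  proof (rule sublinearI)
    fix x y
    have *: "u (x + y) \<le> q x + q' y" if q: "q \<in> C" "q' \<in> C" for q q'
    proof -
      obtain q'' where "q'' \<in> C" "q'' \<le> q" "q'' \<le> q'"
        using chain[OF q] q by blast
      then show ?thesis
        using lower[of q'' "x + y"] sublinear_add[OF sub, of q'' x y]
          le_funD[of q'' q x] le_funD[of q'' q' y] by linarith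
    qed
    have "u (x + y) - q x \<le> u y" if "q \<in> C" for q
      using *[OF that] by (intro greatest) (simp add: algebra_simps)
    then have "u (x + y) - u y \<le> u x"
      by (intro greatest) (simp add: algebra_simps)
    then show "u (x + y) \<le> u x + u y" by simp
  next
    fix r :: real and x
    assume r: "r > 0"
    have "u (sc r x) / r \<le> q x" if "q \<in> C" for q
      using lower[OF that, of "sc r x"] sublinear_scale_le[OF sub[OF that] r, of x] r
      by (simp add: field_simps)
    then have "u (sc r x) / r \<le> u x" by (rule greatest)
    then show "u (sc r x) \<le> r * u x" using r by (simp add: field_simps)
  qed
  then show ?thesis using lower by (auto simp: le_fun_def)
qed

text \<open>Minimality forces \<open>m\<close> to equal its shift along every \<open>y\<close>; the
  parameter \<open>t = 1\<close> then gives \<open>m x + m y \<le> m (x + y)\<close>, the converse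
  of subadditivity.\<close>

lemma minimal_sublinear_linear:
  assumes m: "sublinear sc m" and min: "\<And>q. sublinear sc q \<Longrightarrow> q \<le> m \<Longrightarrow> q = m"
  shows "Vector_Spaces.linear sc (*) m"
proof -
  have add: "m (x + y) = m x + m y" for x y
  proof (rule antisym)
    have "sublinear_shift m y = m"
      by (intro min sublinear_sublinear_shift m le_funI sublinear_shift_le_self)
    then show "m x + m y \<le> m (x + y)"
      using sublinear_shift_le[OF m, of 1 y x] by simp
  qed (rule sublinear_add[OF m])
  have neg: "m (- x) = - m x" for x
    using add[of x "- x"] by (simp add: sublinear_zero[OF m])
  have "m (sc r x) = r * m x" for r x
    using sublinear_scale[OF m, of r x] sublinear_scale[OF m, of "- r" x] neg[of "sc r x"]
    by (cases "r \<ge> 0") auto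
  then show ?thesis
    using add vs
    by (intro Vector_Spaces.linear.intro module_hom.intro module_hom_axioms.intro)
      (auto simp: module_iff_vector_space vector_space_def algebra_simps)
qed

theorem Hahn_Banach_dominated:
  assumes p: "sublinear sc p"
  shows "\<exists>f. Vector_Spaces.linear sc (*) f \<and> f \<le> p"
proof -
  define A where "A = {q. sublinear sc q \<and> q \<le> p}"
  \<comment> \<open>Zorn's lemma is applied to the reversed order, so the maximal element it yields
    is a minimal sublinear functional below \<open>p\<close>.\<close>
  have "\<exists>m\<in>A. \<forall>a\<in>A. m \<ge> a \<longrightarrow> a = m"
  proof (rule predicate_Zorn)
    show "partial_order_on A (relation_of (\<ge>) A)"
      by (rule partial_order_on_relation_ofI) auto
  next
    fix C assume C: "C \<in> Chains (relation_of (\<ge>) A)"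
    then have CA: "C \<subseteq> A" and ch: "\<And>q q'. q \<in> C \<Longrightarrow> q' \<in> C \<Longrightarrow> q \<le> q' \<or> q' \<le> q"
      by (auto simp: Chains_def relation_of_def)
    show "\<exists>u\<in>A. \<forall>a\<in>C. a \<ge> u"
    proof (cases "C = {}")
      case True
      then show ?thesis using p by (auto simp: A_def)
    next
      case False
      obtain u where "sublinear sc u" "\<forall>q\<in>C. u \<le> q"
        using sublinear_chain_lower_bound[OF False _ _ ch, of p] CA by (auto simp: A_def)
      moreover from this False CA have "u \<le> p"
        by (auto simp: A_def intro: order_trans)
      ultimately show ?thesis by (auto simp: A_def)
    qed
  qed
  then obtain m where "sublinear sc m" "m \<le> p" "\<And>q. sublinear sc q \<Longrightarrow> q \<le> m \<Longrightarrow> q = m"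
    by (auto simp: A_def intro: order_trans)
  then show ?thesis using minimal_sublinear_linear by blast
qed

text \<open>A linear \<open>f\<close> below the shift along \<open>x\<close> satisfies
  \<open>f (- x) \<le> p (- x + x) - p x = - p x\<close>, that is,
  \<open>f x \<ge> p x\<close>.\<close>

corollary Hahn_Banach_supporting:
  assumes p: "sublinear sc p"
  shows "\<exists>f. Vector_Spaces.linear sc (*) f \<and> f \<le> p \<and> f x = p x"
proof -
  obtain f where f: "Vector_Spaces.linear sc (*) f" "f \<le> sublinear_shift p x"
    using Hahn_Banach_dominated[OF sublinear_sublinear_shift[OF p]] by blast
  then have "f \<le> p"
    using sublinear_shift_le_self[OF p] by (auto simp: le_fun_def intro: order_trans)
  moreover have "f (- x) \<le> - p x"
    using le_funD[OF f(2), of "- x"] sublinear_shift_le[OF p, of 1 x "- x"]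
    by (simp add: sublinear_zero[OF p])
  moreover have "f (- x) = - f x"
    using f(1) by (rule module_hom.neg[OF Vector_Spaces.linear.axioms(3)])
  ultimately show ?thesis
    using f(1) by (intro exI[of _ f]) (auto simp: le_fun_def intro: antisym)
qed

end

section \<open>Continuous functionals\<close>

definition continuous_functionals ::
    "('k::{field, topological_space} \<Rightarrow> 'a::{ab_group_add, topological_space} \<Rightarrow> 'a) \<Rightarrow> ('a \<Rightarrow> 'k) set" where
  "continuous_functionals sc = {f. Vector_Spaces.linear sc (*) f \<and> continuous_on UNIV f}"

section \<open>Real scalars and gauges of convex neighbourhoods\<close>

context topological_vector_space
begin

lemma vector_space_of_real: "vector_space (\<lambda>r. sc (of_real r))"
  by unfold_locales (simp_all add: scale_right_distrib scale_left_distrib)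

lemma continuous_on_scale:
  assumes "continuous_on S f" "continuous_on S g"
  shows "continuous_on S (\<lambda>x. sc (f x) (g x))"
  using continuous_on_compose2[OF continuous_scale continuous_on_Pair[OF assms]] by simp

text \<open>By continuity \<open>sc (of_real r) x\<close> tends to 0 with \<open>r\<close>, so it
  enters \<open>C\<close> for some \<open>r > 0\<close>; \<open>t = 1 / r\<close> is the form the
  gauge uses.\<close>

lemma convex_nhd_absorbing:
  assumes "0 \<in> interior C"
  shows "\<exists>t>0. sc (of_real (1 / t)) x \<in> C"
proof -
  have "continuous_on UNIV (\<lambda>r::real. sc (of_real r) x)"
    by (intro continuous_on_scale continuous_intros)
  then have "((\<lambda>r. sc (of_real r) x) \<longlongrightarrow> sc (of_real 0) x) (at (0::real))"
    unfolding continuous_on_def by (rule bspec) simp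
  then have "\<forall>\<^sub>F r in at 0. sc (of_real r) x \<in> interior C"
    using assms by (auto dest!: topological_tendstoD[OF _ open_interior])
  then have "\<forall>\<^sub>F r in at_right 0. sc (of_real r) x \<in> interior C \<and> r > 0"
    unfolding eventually_conj_iff by (auto simp: eventually_at_right_less eventually_at_split)
  then obtain r :: real where "r > 0" "sc (of_real r) x \<in> C"
    using interior_subset by (force dest: eventually_happens)
  then show ?thesis by (intro exI[of _ "1 / r"]) auto
qed

text \<open>This is the Minkowski gauge, the infimum of all \<open>t > 0\<close> with
  \<open>x / t\<close> in \<open>C\<close>. Absorption makes it finite, and convexity makes it
  subadditive.\<close>

lemma exists_sublinear_gauge:
  assumes cv: "convex_wrt sc C" and C0: "0 \<in> interior C"
  shows "\<exists>p. sublinear (\<lambda>r. sc (of_real r)) p \<and> (\<forall>x\<in>C. p x \<le> 1) \<and> (\<forall>x. x \<notin> C \<longrightarrow> p x \<ge> 1)"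
proof -
  define A where "A x = {t. t > 0 \<and> sc (of_real (1 / t)) x \<in> C}" for x
  define p where "p x = Inf (A x)" for x
  have 0: "0 \<in> C" using C0 interior_subset by blast
  have ne: "A x \<noteq> {}" for x
    using convex_nhd_absorbing[OF C0, of x] by (auto simp: A_def)
  have bdd: "bdd_below (A x)" for x
    by (intro bdd_belowI[of _ 0]) (auto simp: A_def)
  have lower: "p x \<le> t" if "t \<in> A x" for t x
    unfolding p_def using that bdd by (rule cInf_lower)
  have greatest: "a \<le> p x" if "\<And>t. t \<in> A x \<Longrightarrow> a \<le> t" for a x
    unfolding p_def using that ne by (intro cInf_greatest) auto
  have A_add: "s + t \<in> A (x + y)" if "s \<in> A x" "t \<in> A y" for s t x y
  proof -
    have st: "s > 0" "t > 0" using that by (auto simp: A_def)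
    \<comment> \<open>\<open>(x + y) / (s + t)\<close> is the convex combination of
      \<open>x / s\<close> and \<open>y / t\<close> with weights \<open>s / (s + t)\<close> and
      \<open>t / (s + t)\<close>.\<close>
    have "sc (of_real (s / (s + t))) (sc (of_real (1 / s)) x)
        + sc (of_real (t / (s + t))) (sc (of_real (1 / t)) y) \<in> C"
      by (rule cv[unfolded convex_wrt_def, rule_format])
        (use that st in \<open>auto simp del: of_real_divide simp: A_def add_divide_distrib[symmetric]\<close>)
    also have "of_real (s / (s + t)) * of_real (1 / s) = (of_real (1 / (s + t)) :: 'k)"
      unfolding of_real_mult[symmetric] using st by simp
    then have "sc (of_real (s / (s + t))) (sc (of_real (1 / s)) x) = sc (of_real (1 / (s + t))) x"
      by (simp only: scale_scale)
    also have "of_real (t / (s + t)) * of_real (1 / t) = (of_real (1 / (s + t)) :: 'k)"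
      unfolding of_real_mult[symmetric] using st by simp
    then have "sc (of_real (t / (s + t))) (sc (of_real (1 / t)) y) = sc (of_real (1 / (s + t))) y"
      by (simp only: scale_scale)
    finally show ?thesis
      using st by (simp only: A_def scale_right_distrib mem_Collect_eq) simp
  qed
  have A_scale: "r * t \<in> A (sc (of_real r) x)" if "r > 0" "t \<in> A x" for r t x
  proof -
    have "of_real (1 / (r * t)) * of_real r = (of_real (1 / t) :: 'k)"
      unfolding of_real_mult[symmetric] using that by simp
    then have "sc (of_real (1 / (r * t))) (sc (of_real r) x) = sc (of_real (1 / t)) x"
      by (simp only: scale_scale)
    then show ?thesis using that unfolding A_def by (simp only: mem_Collect_eq) simp
  qed
  have "sublinear (\<lambda>r. sc (of_real r)) p"
  proof (rule sublinearI)
    fix x y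
    have *: "p (x + y) \<le> s + t" if "s \<in> A x" "t \<in> A y" for s t
      using that by (intro lower A_add)
    have "p (x + y) - s \<le> p y" if "s \<in> A x" for s
      using *[OF that] by (intro greatest) (simp add: algebra_simps)
    then have "p (x + y) - p y \<le> p x"
      by (intro greatest) (simp add: algebra_simps)
    then show "p (x + y) \<le> p x + p y" by simp
  next
    fix r :: real and x assume r: "r > 0"
    have "p (sc (of_real r) x) / r \<le> p x"
      using lower[OF A_scale[OF r]] r by (intro greatest) (simp add: field_simps)
    then show "p (sc (of_real r) x) \<le> r * p x" using r by (simp add: field_simps)
  qed
  moreover have "p x \<le> 1" if "x \<in> C" for x
    using that by (intro lower) (simp add: A_def)
  moreover have "p x \<ge> 1" if "x \<notin> C" for x
  proof (rule greatest, rule ccontr)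
    fix t assume t: "t \<in> A x" "\<not> 1 \<le> t"
    \<comment> \<open>If \<open>t < 1\<close>, then \<open>x\<close> is a convex combination of
      \<open>x / t\<close> and 0, both in \<open>C\<close>.\<close>
    then have "sc (of_real t) (sc (of_real (1 / t)) x) + sc (of_real (1 - t)) 0 \<in> C"
      by (intro cv[unfolded convex_wrt_def, rule_format] 0) (auto simp: A_def)
    with t that show False by (simp add: A_def)
  qed
  ultimately show ?thesis by blast
qed

lemma continuous_on_dominated:
  fixes f :: "'a \<Rightarrow> real"
  assumes f: "Vector_Spaces.linear (\<lambda>r. sc (of_real r)) (*) f"
    and C: "0 \<in> interior C" "\<And>x. x \<in> C \<Longrightarrow> f x \<le> 1"
  shows "continuous_on UNIV f"
proof -
  interpret f: Vector_Spaces.linear "\<lambda>r. sc (of_real r)" "(*)" f by (rule f)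
  show ?thesis
    unfolding continuous_on_def
  proof (intro ballI tendstoI)
    fix x and e :: real assume e: "e > 0"
    \<comment> \<open>The factor \<open>2 / e\<close> turns \<open>f \<le> 1\<close> on
      \<open>C\<close> into a bound \<open>e / 2\<close>, strictly below \<open>e\<close>. As
      \<open>C\<close> may be asymmetric, both signs \<open>s\<close> are used to bound the absolute
      value.\<close>
    define g where "g s y = sc (of_real (s * 2 / e)) (y - x)" for s y
    have "open (g s -` interior C)" for s
      unfolding g_def by (intro open_vimage continuous_on_scale continuous_intros) auto
    then have "open (g 1 -` interior C \<inter> g (- 1) -` interior C)" by auto
    moreover have "x \<in> g 1 -` interior C \<inter> g (- 1) -` interior C"
      using C by (simp add: g_def)
    moreover have "dist (f y) (f x) < e" if "y \<in> g 1 -` interior C \<inter> g (- 1) -` interior C" for y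
    proof -
      have "s * 2 / e * (f y - f x) \<le> 1" if "s \<in> {1, - 1}" for s
      proof -
        have "f (g s y) = s * 2 / e * (f y - f x)"
          unfolding g_def by (simp only: f.scale f.diff)
        moreover have "f (g s y) \<le> 1"
          using that \<open>y \<in> _\<close> C(2) interior_subset[of C] by auto
        ultimately show ?thesis by simp
      qed
      from this[of 1] this[of "- 1"] have "2 * (f y - f x) \<le> e" "2 * (f x - f y) \<le> e"
        using e by (simp_all add: field_simps)
      then show ?thesis
        using e by (simp add: dist_real_def abs_less_iff)
    qed
    ultimately show "\<forall>\<^sub>F y in at x within UNIV. dist (f y) (f x) < e"
      unfolding eventually_at_topological by blast
  qed
qed

end

section \<open>Separation of points by continuous functionals\<close>

text \<open>The gauge \<open>p\<close> of a convex neighbourhood \<open>C\<close> missing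
  \<open>x\<close> has \<open>p x \<ge> 1\<close>. A functional supporting \<open>p\<close> at
  \<open>x\<close> is nonzero there, and \<open>f \<le> p \<le> 1\<close> on \<open>C\<close> makes
  it continuous.\<close>

lemma (in locally_convex_space) exists_real_functional:
  assumes "x \<noteq> 0"
  shows "\<exists>f. Vector_Spaces.linear (\<lambda>r. sc (of_real r)) (*) f \<and> continuous_on UNIV f \<and> f x \<noteq> (0::real)"
proof -
  have "open (- {x})" "0 \<in> - {x}" using assms by auto
  then obtain C where C: "convex_wrt sc C" "0 \<in> interior C" "C \<subseteq> - {x}"
    using convex_nhd_base by blast
  then obtain p where p: "sublinear (\<lambda>r. sc (of_real r)) p"
    and pC: "\<And>x. x \<in> C \<Longrightarrow> p x \<le> 1" "\<And>x. x \<notin> C \<Longrightarrow> p x \<ge> 1"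
    using exists_sublinear_gauge by meson
  obtain f where f: "Vector_Spaces.linear (\<lambda>r. sc (of_real r)) (*) f" "f \<le> p" "f x = p x"
    using Hahn_Banach_supporting[OF vector_space_of_real p] by blast
  have "continuous_on UNIV f"
    using f(2) pC(1) order_trans
    by (intro continuous_on_dominated[OF f(1) C(2)]) (fastforce simp: le_fun_def)
  moreover have "f x \<noteq> 0" using C(3) pC(2)[of x] f(3) by auto
  ultimately show ?thesis using f(1) by blast
qed

text \<open>Local convexity enters the operator part only through this property, so that part is
  proved once for both scalar fields.\<close>

locale separated_by_functionals = topological_vector_space sc
  for sc :: "'k::real_normed_field \<Rightarrow> 'a::{topological_ab_group_add, t2_space} \<Rightarrow> 'a" +
  assumes exists_functional: "x \<noteq> 0 \<Longrightarrow> \<exists>f\<in>continuous_functionals sc. f x \<noteq> 0"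

lemma separated_real:
  fixes sc :: "real \<Rightarrow> 'a::{topological_ab_group_add, t2_space} \<Rightarrow> 'a"
  assumes "locally_convex_space sc"
  shows "separated_by_functionals sc"
proof -
  interpret locally_convex_space sc by fact
  show ?thesis
    using exists_real_functional
    by unfold_locales (auto simp: continuous_functionals_def)
qed

text \<open>A real functional \<open>f\<close> is the real part of the complex linear functional
  \<open>f y - \<i> * f (sc \<i> y)\<close>.\<close>

lemma separated_complex:
  fixes sc :: "complex \<Rightarrow> 'a::{topological_ab_group_add, t2_space} \<Rightarrow> 'a"
  assumes "locally_convex_space sc"
  shows "separated_by_functionals sc"
proof -
  interpret locally_convex_space sc by fact
  show ?thesis
  proof
    fix x :: 'a assume "x \<noteq> 0"
    then obtain f where f: "Vector_Spaces.linear (\<lambda>r. sc (of_real r)) (*) f"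
      and cont: "continuous_on UNIV f" and fx: "f x \<noteq> (0::real)"
      using exists_real_functional by blast
    interpret f: Vector_Spaces.linear "\<lambda>r. sc (of_real r)" "(*)" f by (rule f)
    define F where "F y = Complex (f y) (- f (sc \<i> y))" for y
    have "F (sc c y) = c * F y" for c y
    proof -
      have "f (sc c y) = Re c * f y + Im c * f (sc \<i> y)" for c y
      proof -
        have "sc c y = sc (of_real (Re c)) y + sc (of_real (Im c)) (sc \<i> y)"
          unfolding scale_scale scale_left_distrib[symmetric]
          by (subst complex_eq[of c]) (simp add: mult.commute)
        then show ?thesis by (simp only: f.add f.scale)
      qed
      \<comment> \<open>The instance for \<open>\<i> * c\<close> computes, up to sign, the imaginary
        part of \<open>F (sc c y)\<close>.\<close>
      from this[of c y] this[of "\<i> * c" y] show ?thesis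
        by (simp add: F_def complex_eq_iff)
    qed
    moreover have "F (y + z) = F y + F z" for y z
      by (simp add: F_def complex_eq_iff scale_right_distrib f.add)
    ultimately have "Vector_Spaces.linear sc (*) F"
      by unfold_locales (auto simp: algebra_simps)
    moreover have "continuous_on UNIV (\<lambda>y. f (sc \<i> y))"
      by (rule continuous_on_compose2[OF cont]) (auto intro: continuous_on_scale continuous_intros)
    then have "continuous_on UNIV F"
      unfolding F_def Complex_eq using cont by (intro continuous_intros)
    moreover have "F x \<noteq> 0" using fx by (simp add: F_def complex_eq_iff)
    ultimately show "\<exists>f\<in>continuous_functionals sc. f x \<noteq> 0"
      by (auto simp: continuous_functionals_def)
  qed
qed

section \<open>Operators of finite rank\<close>

context topological_vector_space
begin

text \<open>Stated for differences because biorthogonalisation subtracts; sums arise with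
  \<open>d = - 1\<close>.\<close>

lemma continuous_functionals_scale_diff:
  assumes "f \<in> continuous_functionals sc" "g \<in> continuous_functionals sc"
  shows "(\<lambda>x. c * f x - d * g x) \<in> continuous_functionals sc"
proof -
  interpret f: Vector_Spaces.linear sc "(*)" f using assms by (simp add: continuous_functionals_def)
  interpret g: Vector_Spaces.linear sc "(*)" g using assms by (simp add: continuous_functionals_def)
  have "Vector_Spaces.linear sc (*) (\<lambda>x. c * f x - d * g x)"
    by unfold_locales (simp_all add: f.add g.add f.scale g.scale algebra_simps)
  then show ?thesis
    using assms by (auto simp: continuous_functionals_def intro!: continuous_intros)
qed

lemma continuous_functionals_sum:
  assumes "finite B" "\<And>b. b \<in> B \<Longrightarrow> f b \<in> continuous_functionals sc"
  shows "(\<lambda>x. \<Sum>b\<in>B. c b * f b x) \<in> continuous_functionals sc"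
  using assms
proof (induction B rule: finite_induct)
  case empty
  interpret P: vector_space_pair sc "(*)" by unfold_locales (auto simp: algebra_simps)
  show ?case by (simp add: continuous_functionals_def P.linear_zero)
next
  case (insert b B)
  then show ?case
    using continuous_functionals_scale_diff[of "f b" "\<lambda>x. \<Sum>b\<in>B. c b * f b x" "c b" "- 1"] by simp
qed

end

section \<open>Biorthogonal functionals\<close>

context separated_by_functionals
begin

text \<open>Gram--Schmidt: the new vector is replaced by its component \<open>z\<close> complementary to the span of
  \<open>B\<close>, on which some functional is nonzero.\<close>

lemma exists_biorthogonal:
  assumes "finite B" "independent B"
  shows "\<exists>f. \<forall>b\<in>B. f b \<in> continuous_functionals sc \<and> (\<forall>b'\<in>B. f b b' = (if b = b' then 1 else 0))"
  using assms
proof (induction B rule: finite_induct)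
  case (insert e B)
  then have e: "e \<notin> span B" and "independent B"
    using independent_insert[of e B] by auto
  with insert.IH obtain f where
    "\<forall>b\<in>B. f b \<in> continuous_functionals sc \<and> (\<forall>b'\<in>B. f b b' = (if b = b' then 1 else 0))"
    by blast
  then have f: "\<And>b. b \<in> B \<Longrightarrow> f b \<in> continuous_functionals sc"
      "\<And>b b'. b \<in> B \<Longrightarrow> b' \<in> B \<Longrightarrow> f b b' = (if b = b' then 1 else 0)"
    by auto
  define z where "z = e - (\<Sum>b\<in>B. sc (f b e) b)"
  have "(\<Sum>b\<in>B. sc (f b e) b) \<in> span B"
    by (intro span_sum span_scale span_base)
  with e have "z \<noteq> 0" by (auto simp: z_def)
  then obtain g where g: "g \<in> continuous_functionals sc" and gz: "g z \<noteq> 0"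
    using exists_functional by blast
  interpret g: Vector_Spaces.linear sc "(*)" g using g by (simp add: continuous_functionals_def)
  \<comment> \<open>The subtracted sum agrees with \<open>g\<close> on \<open>B\<close>, so
    \<open>h\<close> vanishes there; at \<open>e\<close> the difference is \<open>g z\<close>, which
    the factor normalises to 1.\<close>
  define h where "h x = (1 / g z) * g x - (1 / g z) * (\<Sum>b\<in>B. g b * f b x)" for x
  have h: "h \<in> continuous_functionals sc"
    unfolding h_def[abs_def]
    by (intro continuous_functionals_scale_diff g continuous_functionals_sum insert.hyps f)
  have "g z = g e - (\<Sum>b\<in>B. g b * f b e)"
    by (simp add: z_def g.diff g.sum g.scale mult.commute)
  then have he: "h e = 1"
    using gz by (simp add: h_def diff_divide_distrib[symmetric])
  have hB: "h b = 0" if "b \<in> B" for b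
  proof -
    have "(\<Sum>b'\<in>B. g b' * f b' b) = (\<Sum>b'\<in>B. if b' = b then g b' else 0)"
      by (intro sum.cong) (auto simp: f that)
    then show ?thesis using insert.hyps that by (simp add: h_def)
  qed
  \<comment> \<open>Each old functional loses its value at \<open>e\<close> by subtracting a
    multiple of \<open>h\<close>; its values on \<open>B\<close> stay the same since
    \<open>h\<close> is 0 there.\<close>
  define f' where "f' b = (if b = e then h else (\<lambda>x. 1 * f b x - f b e * h x))" for b
  have "f' b \<in> continuous_functionals sc" if "b \<in> insert e B" for b
    using that h f(1) continuous_functionals_scale_diff[of "f b" h 1]
    by (cases "b = e") (simp_all add: f'_def)
  moreover have "f' b b' = (if b = b' then 1 else 0)" if "b \<in> insert e B" "b' \<in> insert e B" for b b'
    using that insert.hyps by (auto simp: f'_def he hB f)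
  ultimately show ?case by blast
qed simp

end

section \<open>The space of finite rank operators\<close>

definition finite_rank_operators ::
    "('k::field \<Rightarrow> 'a::{ab_group_add, topological_space} \<Rightarrow> 'a) \<Rightarrow> ('a \<Rightarrow> 'a) set" where
  "finite_rank_operators sc =
     {T \<in> continuous_operators sc. \<exists>B. finite B \<and> range T \<subseteq> module.span sc B}"

context topological_vector_space
begin

lemma subspace_finite_rank_operators:
  "module.subspace (scale_fun sc) (finite_rank_operators sc)"
proof -
  interpret F: vector_space "scale_fun sc"
    by (rule vector_space_scale_fun) unfold_locales
  have L: "F.subspace (continuous_operators sc)"
    by (rule subspace_continuous_operators) unfold_locales
  show ?thesis
    unfolding F.subspace_def
  proof (intro conjI ballI allI)
    show "0 \<in> finite_rank_operators sc"
      using F.subspace_0[OF L] span_zero[of "{}"]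
      by (auto simp: finite_rank_operators_def zero_fun_def)
  next
    fix S T assume "S \<in> finite_rank_operators sc" "T \<in> finite_rank_operators sc"
    then obtain B B' where ST: "S \<in> continuous_operators sc" "T \<in> continuous_operators sc"
      and B: "finite B" "range S \<subseteq> span B" "finite B'" "range T \<subseteq> span B'"
      by (auto simp: finite_rank_operators_def)
    have "range (S + T) \<subseteq> span (B \<union> B')"
      using B span_mono[of B "B \<union> B'"] span_mono[of B' "B \<union> B'"]
      by (auto simp: plus_fun_def intro!: span_add)
    then show "S + T \<in> finite_rank_operators sc"
      using F.subspace_add[OF L ST] B unfolding finite_rank_operators_def by blast
  next
    fix c T assume "T \<in> finite_rank_operators sc"
    then obtain B where T: "T \<in> continuous_operators sc" and B: "finite B" "range T \<subseteq> span B"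
      by (auto simp: finite_rank_operators_def)
    have "range (scale_fun sc c T) \<subseteq> span B"
      using B by (auto simp: scale_fun_def intro!: span_scale)
    then show "scale_fun sc c T \<in> finite_rank_operators sc"
      using F.subspace_scale[OF L T] B unfolding finite_rank_operators_def by blast
  qed
qed

text \<open>A finite spanning set contains a finite basis, which is what
  \<open>infinite_dimensional\<close> excludes.\<close>

lemma span_finite_not_UNIV:
  assumes "infinite_dimensional sc" "finite B"
  shows "span B \<noteq> UNIV"
proof
  assume *: "span B = UNIV"
  obtain B' where B': "B' \<subseteq> B" "independent B'" "B \<subseteq> span B'"
    using maximal_independent_subset by blast
  then have "span B' = UNIV"
    using * span_minimal[OF B'(3)] subspace_span by blast
  then have "finite_dimensional_vector_space sc B'"
    using B' finite_subset[OF _ assms(2)] by unfold_locales auto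
  then show False using assms(1) by (auto simp: infinite_dimensional_def)
qed

lemma finite_rank_operator_not_injective:
  assumes inf: "infinite_dimensional sc" and T: "T \<in> finite_rank_operators sc"
  shows "\<not> inj T"
proof
  assume "inj T"
  interpret T: Vector_Spaces.linear sc sc T
    using T by (simp add: finite_rank_operators_def continuous_operators_def)
  obtain B where B: "finite B" "range T \<subseteq> span B"
    using T by (auto simp: finite_rank_operators_def)
  obtain E where E: "independent E" "UNIV \<subseteq> span E"
    by (rule maximal_independent_subset[of UNIV])
  have "independent (T ` E)"
    by (rule T.independent_injective_image[OF E(1) inj_on_subset[OF \<open>inj T\<close> subset_UNIV]])
  then have "finite (T ` E)"
    using independent_span_bound[OF B(1), of "T ` E"] B(2) by blast
  then have "finite E"
    using \<open>inj T\<close> by (meson finite_imageD inj_on_subset subset_UNIV)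
  then show False using span_finite_not_UNIV[OF inf] E(2) by blast
qed

end

section \<open>SOT-density of the finite rank operators\<close>

context separated_by_functionals
begin

text \<open>Passing to a basis \<open>B \<subseteq> I\<close> of the span of \<open>I\<close> allows
  for dependent points. Functionals biorthogonal to \<open>B\<close> serve as coordinates, and
  agreement on \<open>B\<close> extends to \<open>I\<close> by linearity.\<close>

lemma finite_rank_operator_interpolation:
  assumes T: "T \<in> continuous_operators sc" and "finite I"
  shows "\<exists>S\<in>finite_rank_operators sc. \<forall>x\<in>I. S x = T x"
proof -
  interpret P: vector_space_pair sc sc ..
  interpret T: Vector_Spaces.linear sc sc T using T by (simp add: continuous_operators_def)
  obtain B where B: "B \<subseteq> I" "independent B" "I \<subseteq> span B"
    using maximal_independent_subset by blast
  then have finB: "finite B" using \<open>finite I\<close> finite_subset by blast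
  then obtain f where
    "\<forall>b\<in>B. f b \<in> continuous_functionals sc \<and> (\<forall>b'\<in>B. f b b' = (if b = b' then 1 else 0))"
    using exists_biorthogonal[OF _ B(2)] by blast
  then have f: "\<And>b. b \<in> B \<Longrightarrow> f b \<in> continuous_functionals sc"
      "\<And>b b'. b \<in> B \<Longrightarrow> b' \<in> B \<Longrightarrow> f b b' = (if b = b' then 1 else 0)"
    by auto
  define S where "S x = (\<Sum>b\<in>B. sc (f b x) (T b))" for x
  have lin: "f b (x + y) = f b x + f b y" "f b (sc c x) = c * f b x" if "b \<in> B" for b c x y
    using f(1)[OF that] Vector_Spaces.linear.axioms(3)[of sc "(*)" "f b"]
    by (auto simp: continuous_functionals_def dest: module_hom.add module_hom.scale)
  have S: "Vector_Spaces.linear sc sc S"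
    by unfold_locales
      (simp_all add: S_def lin scale_left_distrib sum.distrib scale_sum_right)
  have "continuous_on UNIV S"
    unfolding S_def using f(1)
    by (intro continuous_on_sum continuous_on_scale) (auto simp: continuous_functionals_def)
  moreover have "range S \<subseteq> span (T ` B)"
    by (auto simp: S_def intro!: span_sum span_scale intro: span_base)
  ultimately have "S \<in> finite_rank_operators sc"
    using S finB by (auto simp: finite_rank_operators_def continuous_operators_def)
  moreover have "S b = T b" if "b \<in> B" for b
  proof -
    have "S b = (\<Sum>b'\<in>B. if b' = b then T b' else 0)"
      unfolding S_def by (intro sum.cong) (auto simp: f that)
    then show ?thesis using finB that by simp
  qed
  then have "S x = T x" if "x \<in> span B" for x
    using P.linear_eq_on[OF S T.linear_axioms that] by blast
  ultimately show ?thesis using B(3) by blast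
qed

lemma sot_dense_finite_rank_operators:
  "sot sc closure_of finite_rank_operators sc = continuous_operators sc"
proof
  show "sot sc closure_of finite_rank_operators sc \<subseteq> continuous_operators sc"
    using closure_of_subset_topspace[of "sot sc"] by simp
  show "continuous_operators sc \<subseteq> sot sc closure_of finite_rank_operators sc"
  proof
    fix T assume T: "T \<in> continuous_operators sc"
    have "\<exists>S\<in>finite_rank_operators sc. S \<in> W" if W: "openin (sot sc) W" "T \<in> W" for W
    proof -
      obtain W' where W': "openin (product_topology (\<lambda>_. euclidean) UNIV) W'"
        and WW': "W = W' \<inter> continuous_operators sc"
        using W(1) by (auto simp: sot_def openin_subtopology)
      \<comment> \<open>A basic product neighbourhood restricts only finitely many points, and there
        the interpolating operator equals \<open>T\<close> exactly.\<close>
      then obtain U where U: "finite {x. U x \<noteq> UNIV}" "T \<in> Pi\<^sub>E UNIV U" "Pi\<^sub>E UNIV U \<subseteq> W'"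
        using W(2) by (force simp: openin_product_topology_alt)
      obtain S where S: "S \<in> finite_rank_operators sc" "\<forall>x\<in>{x. U x \<noteq> UNIV}. S x = T x"
        using finite_rank_operator_interpolation[OF T U(1)] by blast
      have "S x \<in> U x" for x
        using S(2) U(2) by (cases "U x = UNIV") (auto simp: PiE_iff)
      then have "S \<in> W'" using U(3) by (auto simp: PiE_iff)
      then show ?thesis using S(1) WW' by (auto simp: finite_rank_operators_def)
    qed
    then show "T \<in> sot sc closure_of finite_rank_operators sc"
      using T by (auto simp: in_closure_of)
  qed
qed

section \<open>Finite-dimensional subspaces are not dense\<close>

text \<open>For \<open>x\<close> outside the span, a functional with value 1 at \<open>x\<close> and
  0 on a basis of the span has a closed kernel that contains the span and misses
  \<open>x\<close>.\<close>

lemma closure_span_finite_not_UNIV: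
  assumes inf: "infinite_dimensional sc" and fin: "finite B"
  shows "closure (span B) \<noteq> UNIV"
proof -
  obtain B' where B': "B' \<subseteq> B" "independent B'" "B \<subseteq> span B'"
    using maximal_independent_subset by blast
  have finB': "finite B'" using B'(1) fin finite_subset by blast
  then obtain x where x: "x \<notin> span B'" using span_finite_not_UNIV[OF inf] by blast
  then have "independent (insert x B')" and xB': "x \<notin> B'"
    using B'(2) span_base by (auto simp: independent_insert)
  then obtain f where f: "f x \<in> continuous_functionals sc"
      "\<And>b. b \<in> insert x B' \<Longrightarrow> f x b = (if x = b then 1 else 0)"
    using exists_biorthogonal[of "insert x B'"] finB' by (metis finite_insert insertI1)
  interpret fx: Vector_Spaces.linear sc "(*)" "f x" using f by (simp add: continuous_functionals_def)
  have "span B' \<subseteq> {y. f x y = 0}"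
    using f(2) xB' by (intro span_minimal fx.subspace_kernel) auto
  moreover have "span B \<subseteq> span B'"
    using B'(3) by (intro span_minimal subspace_span)
  moreover have "closed {y. f x y = 0}"
    using f(1) by (intro closed_Collect_eq) (auto simp: continuous_functionals_def)
  ultimately have "closure (span B) \<subseteq> {y. f x y = 0}"
    by (intro closure_minimal) auto
  moreover have "f x x = 1" using f(2) by simp
  ultimately have "x \<notin> closure (span B)" by auto
  then show ?thesis by blast
qed

lemma closure_subset_span_finite_not_UNIV:
  assumes "infinite_dimensional sc" "finite B" "S \<subseteq> span B"
  shows "closure S \<noteq> UNIV"
  using closure_mono[OF assms(3)] closure_span_finite_not_UNIV[OF assms(1,2)] by auto

theorem sot_dense_lineable_not_dense_cyclic_injective:
  assumes inf: "infinite_dimensional sc"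
  shows "sot_dense_lineable sc (continuous_operators sc -
           (dense_range_operators sc \<union> cyclic_operators sc \<union> injective_operators sc))"
proof -
  have not_dense: "T \<notin> dense_range_operators sc"
    and not_cyclic: "T \<notin> cyclic_operators sc"
    and not_inj: "T \<notin> injective_operators sc" if T: "T \<in> finite_rank_operators sc" for T
  proof -
    obtain B where B: "finite B" "range T \<subseteq> span B"
      using T by (auto simp: finite_rank_operators_def)
    show "T \<notin> dense_range_operators sc"
      using closure_subset_span_finite_not_UNIV[OF inf B] by (simp add: dense_range_operators_def)
    \<comment> \<open>The zeroth iterate is \<open>x\<close> and all later ones lie in
      \<open>range T\<close>, so adding one vector to \<open>B\<close> captures the whole
      orbit.\<close>
    have "span (range (\<lambda>n. (T ^^ n) x)) \<subseteq> span (insert x B)" for x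
    proof (intro span_minimal subspace_span image_subsetI)
      fix n show "(T ^^ n) x \<in> span (insert x B)"
        using B(2) span_mono[of B "insert x B"] by (cases n) (auto intro: span_base)
    qed
    then have "closure (span (range (\<lambda>n. (T ^^ n) x))) \<noteq> UNIV" for x
      by (rule closure_subset_span_finite_not_UNIV[OF inf finite.insertI[OF B(1)]])
    then show "T \<notin> cyclic_operators sc"
      by (simp add: cyclic_operators_def)
    show "T \<notin> injective_operators sc"
      using finite_rank_operator_not_injective[OF inf T] by (simp add: injective_operators_def)
  qed
  have "finite_rank_operators sc \<subseteq> continuous_operators sc"
    by (auto simp: finite_rank_operators_def)
  then show ?thesis
    unfolding sot_dense_lineable_def dense_lineable_def
    using subspace_finite_rank_operators sot_dense_finite_rank_operators
      not_dense not_cyclic not_inj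
    by (auto intro!: exI[of _ "finite_rank_operators sc"])
qed

end

text \<open>There is one conjunct per scalar field, each over its own carrier type; separation by
  functionals reduces both to the common result.\<close>

theorem theorem3p1:
  fixes scaleR' :: "real \<Rightarrow> 'a::{topological_ab_group_add, t2_space} \<Rightarrow> 'a"
    and scaleC' :: "complex \<Rightarrow> 'b::{topological_ab_group_add, t2_space} \<Rightarrow> 'b"
  shows
    "(locally_convex_space scaleR' \<and> infinite_dimensional scaleR' \<longrightarrow>
        sot_dense_lineable scaleR'
          (continuous_operators scaleR' -
            (dense_range_operators scaleR' \<union> cyclic_operators scaleR' \<union> injective_operators scaleR'))) \<and>
     (locally_convex_space scaleC' \<and> infinite_dimensional scaleC' \<longrightarrow>
        sot_dense_lineable scaleC'
          (continuous_operators scaleC' -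
            (dense_range_operators scaleC' \<union> cyclic_operators scaleC' \<union> injective_operators scaleC')))"
  using separated_by_functionals.sot_dense_lineable_not_dense_cyclic_injective[OF separated_real]
    separated_by_functionals.sot_dense_lineable_not_dense_cyclic_injective[OF separated_complex] by blast

end
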